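(* Let $n\ge 2$ be an integer and let $a=N_a(\cosh\theta+\varepsilon\sinh\theta)\in S_1$, where $\theta\in\mathbb{R}$ and $\varepsilon\in E_1$. Consider the equation $w^n=a$ with unknown $w\in C\ell_2$. (i) If $n$ is odd, then the equation $w^n=a$ has only one root $$w=\sqrt[n]{N_a}\Big(\cosh\frac{\theta}{n}+\varepsilon\sinh\frac{\theta}{n}\Big).$$ (ii) If $n$ is even, then the equation $w^n=a$ has two roots $$w=\sqrt[n]{N_a}\Big(\cosh\frac{\theta}{n}+\varepsilon\sinh\frac{\theta}{n}\Big)\quad\text{and}\quad w=\sqrt[n]{N_a}\Big(\sinh\frac{\theta}{n}+\varepsilon\cosh\frac{\theta}{n}\Big).$$
   Context: $C\ell_2=C\ell_{2,0}$ is the associative unital real algebra with $\mathbb{R}$-basis $\mathbf{e}_0=1,\mathbf{e}_1,\mathbf{e}_2,\mathbf{e}_3$ and multiplication rules $\mathbf{e}_1^2=\mathbf{e}_2^2=1$, $\mathbf{e}_3^2=-1$, $\mathbf{e}_1\mathbf{e}_2=\mathbf{e}_3=-\mathbf{e}_2\mathbf{e}_1$, $\mathbf{e}_2\mathbf{e}_3=-\mathbf{e}_1=-\mathbf{e}_3\mathbf{e}_2$, $\mathbf{e}_3\mathbf{e}_1=-\mathbf{e}_2=-\mathbf{e}_1\mathbf{e}_3$. For $a=a_0+a_1\mathbf{e}_1+a_2\mathbf{e}_2+a_3\mathbf{e}_3$ with $a_i\in\mathbb{R}$: $I_a=a_0^2-a_1^2-a_2^2+a_3^2$, $N_a=\sqrt{|I_a|}$,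 $V_a=a_1^2+a_2^2-a_3^2$. $S_1=\{a\in C\ell_2: I_a>0,\ V_a>0\}$. $E_1=\{\epsilon_1\mathbf{e}_1+\epsilon_2\mathbf{e}_2+\epsilon_3\mathbf{e}_3:\epsilon_i\in\mathbb{R},\ \epsilon_1^2+\epsilon_2^2-\epsilon_3^2=1\}$. $\sqrt[n]{\cdot}$ is the real $n$th root.
   Formalization: In (ii) the two listed w are not the only roots, since for even n their negatives are roots too; it is proved instead that both are roots, are distinct even up to sign, and that every root is one of them or the negative of one of them. *)

theory Defs
  imports Complex_Main
begin

text \<open>The real Clifford algebra of signature (2,0), with elements given by their coordinates
  in the basis \<open>1, e1, e2, e3\<close>.\<close>

codatatype cl2 = Cl2 (c0: real) (c1: real) (c2: real) (c3: real)

lemma cl2_eqI [intro?]: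
  "\<lbrakk>c0 x = c0 y; c1 x = c1 y; c2 x = c2 y; c3 x = c3 y\<rbrakk> \<Longrightarrow> x = y"
  by (rule cl2.expand) simp

lemma cl2_eq_iff: "x = y \<longleftrightarrow> c0 x = c0 y \<and> c1 x = c1 y \<and> c2 x = c2 y \<and> c3 x = c3 y"
  by (auto intro: cl2.expand)

instantiation cl2 :: real_algebra_1
begin

primcorec zero_cl2 where
  "c0 0 = 0" | "c1 0 = 0" | "c2 0 = 0" | "c3 0 = 0"

primcorec one_cl2 where
  "c0 1 = 1" | "c1 1 = 0" | "c2 1 = 0" | "c3 1 = 0"

primcorec plus_cl2 where
  "c0 (x + y) = c0 x + c0 y"
| "c1 (x + y) = c1 x + c1 y"
| "c2 (x + y) = c2 x + c2 y"
| "c3 (x + y) = c3 x + c3 y"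

primcorec uminus_cl2 where
  "c0 (- x) = - c0 x"
| "c1 (- x) = - c1 x"
| "c2 (- x) = - c2 x"
| "c3 (- x) = - c3 x"

primcorec minus_cl2 where
  "c0 (x - y) = c0 x - c0 y"
| "c1 (x - y) = c1 x - c1 y"
| "c2 (x - y) = c2 x - c2 y"
| "c3 (x - y) = c3 x - c3 y"

primcorec scaleR_cl2 where
  "c0 (scaleR r x) = r * c0 x"
| "c1 (scaleR r x) = r * c1 x"
| "c2 (scaleR r x) = r * c2 x"
| "c3 (scaleR r x) = r * c3 x"

text \<open>The bilinear extension of the multiplication table of the basis; the table itself is
  recovered in \<open>cl2_mult_table\<close> below.\<close>

primcorec times_cl2 where
  "c0 (x * y) = c0 x * c0 y + c1 x * c1 y + c2 x * c2 y - c3 x * c3 y"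
| "c1 (x * y) = c0 x * c1 y + c1 x * c0 y - c2 x * c3 y + c3 x * c2 y"
| "c2 (x * y) = c0 x * c2 y + c2 x * c0 y + c1 x * c3 y - c3 x * c1 y"
| "c3 (x * y) = c0 x * c3 y + c3 x * c0 y + c1 x * c2 y - c2 x * c1 y"

instance
  by standard (simp_all add: cl2_eq_iff algebra_simps)

end

definition e1 :: cl2 where "e1 = Cl2 0 1 0 0"
definition e2 :: cl2 where "e2 = Cl2 0 0 1 0"
definition e3 :: cl2 where "e3 = Cl2 0 0 0 1"

lemma cl2_basis: "Cl2 a0 a1 a2 a3 = a0 *\<^sub>R 1 + a1 *\<^sub>R e1 + a2 *\<^sub>R e2 + a3 *\<^sub>R e3"
  by (simp add: cl2_eq_iff e1_def e2_def e3_def)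

lemma cl2_mult_table:
  "e1 * e1 = 1" "e2 * e2 = 1" "e3 * e3 = -1"
  "e1 * e2 = e3" "e2 * e1 = - e3"
  "e2 * e3 = - e1" "e3 * e2 = e1"
  "e3 * e1 = - e2" "e1 * e3 = e2"
  by (simp_all add: cl2_eq_iff e1_def e2_def e3_def)

definition I_cl2 :: "cl2 \<Rightarrow> real" where
  "I_cl2 a = (c0 a)\<^sup>2 - (c1 a)\<^sup>2 - (c2 a)\<^sup>2 + (c3 a)\<^sup>2"

definition N_cl2 :: "cl2 \<Rightarrow> real" where
  "N_cl2 a = sqrt \<bar>I_cl2 a\<bar>"

definition V_cl2 :: "cl2 \<Rightarrow> real" where
  "V_cl2 a = (c1 a)\<^sup>2 + (c2 a)\<^sup>2 - (c3 a)\<^sup>2"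

definition S1 :: "cl2 set" where
  "S1 = {a. I_cl2 a > 0 \<and> V_cl2 a > 0}"

definition E1 :: "cl2 set" where
  "E1 = {x1 *\<^sub>R e1 + x2 *\<^sub>R e2 + x3 *\<^sub>R e3 | x1 x2 x3 :: real. x1\<^sup>2 + x2\<^sup>2 - x3\<^sup>2 = 1}"

end

theory Submission imports Defs begin

text \<open>Since \<open>\<epsilon>\<^sup>2 = 1\<close>, the elements \<open>(1 + \<epsilon>) / 2\<close> and \<open>(1 - \<epsilon>) / 2\<close> are complementary orthogonal
  idempotents. A root \<open>w\<close> commutes with \<open>a = w ^ n\<close>, hence with \<open>\<epsilon>\<close> (as \<open>V\<^sub>a > 0\<close> forces
  \<open>sinh \<theta> \<noteq> 0\<close>), and the centralizer of \<open>\<epsilon>\<close> is spanned by \<open>1\<close> and \<open>\<epsilon>\<close>. So the equation splits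
  along the idempotents into the two real equations \<open>x ^ n = N\<^sub>a exp \<theta>\<close> and
  \<open>y ^ n = N\<^sub>a exp (- \<theta>)\<close>.\<close>

lemma of_real_cl2_sel [simp]:
  "c0 (of_real r) = r" "c1 (of_real r) = 0" "c2 (of_real r) = 0" "c3 (of_real r) = 0"
  by (simp_all add: of_real_def)

lemma E1_iff: "\<epsilon> \<in> E1 \<longleftrightarrow> c0 \<epsilon> = 0 \<and> V_cl2 \<epsilon> = 1"
  unfolding E1_def V_cl2_def
  by (auto simp: cl2_eq_iff e1_def e2_def e3_def)

lemma E1_square: "\<epsilon> \<in> E1 \<Longrightarrow> \<epsilon> * \<epsilon> = 1"
  by (simp add: E1_iff V_cl2_def cl2_eq_iff power2_eq_square)

text \<open>Commuting with \<open>\<epsilon>\<close> makes all 2x2 minors of the vector parts of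
  \<open>w\<close> and \<open>\<epsilon>\<close> vanish, so these parts are parallel. As
  \<open>V_cl2 \<epsilon> = 1\<close>, the factor is their product under the bilinear form
  polarizing \<open>V_cl2\<close>.\<close>

lemma E1_centralizer:
  assumes "\<epsilon> \<in> E1" and "w * \<epsilon> = \<epsilon> * w"
  shows "w = of_real (c0 w) + (c1 w * c1 \<epsilon> + c2 w * c2 \<epsilon> - c3 w * c3 \<epsilon>) *\<^sub>R \<epsilon>"
proof -
  have e: "c0 \<epsilon> = 0" "c1 \<epsilon> * c1 \<epsilon> + c2 \<epsilon> * c2 \<epsilon> - c3 \<epsilon> * c3 \<epsilon> = 1"
    using assms(1) by (simp_all add: E1_iff V_cl2_def power2_eq_square)
  have c: "c2 w * c3 \<epsilon> = c3 w * c2 \<epsilon>" "c1 w * c3 \<epsilon> = c3 w * c1 \<epsilon>"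
    "c1 w * c2 \<epsilon> = c2 w * c1 \<epsilon>"
    using assms(2) e(1) by (simp_all add: cl2_eq_iff algebra_simps)
  define t where "t = c1 w * c1 \<epsilon> + c2 w * c2 \<epsilon> - c3 w * c3 \<epsilon>"
  have "c1 w = t * c1 \<epsilon>" "c2 w = t * c2 \<epsilon>" "c3 w = t * c3 \<epsilon>"
    using c e(2) unfolding t_def by algebra+
  then show ?thesis
    unfolding t_def by (simp add: cl2_eq_iff e(1))
qed

text \<open>This is \<open>x (1 + \<epsilon>) / 2 + y (1 - \<epsilon>) / 2\<close>, regrouped along
  \<open>1\<close> and \<open>\<epsilon>\<close>: \<open>x\<close> and \<open>y\<close> are the
  coordinates with respect to the two idempotents.\<close>

definition idem_comb :: "cl2 \<Rightarrow> real \<Rightarrow> real \<Rightarrow> cl2" where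
  "idem_comb \<epsilon> x y = of_real ((x + y) / 2) + ((x - y) / 2) *\<^sub>R \<epsilon>"

lemma of_real_plus_scaleR_eq_idem_comb:
  "of_real s + t *\<^sub>R \<epsilon> = idem_comb \<epsilon> (s + t) (s - t)"
  by (simp add: idem_comb_def)

lemma scaleR_idem_comb: "r *\<^sub>R idem_comb \<epsilon> x y = idem_comb \<epsilon> (r * x) (r * y)"
  by (simp add: idem_comb_def cl2_eq_iff algebra_simps)

lemma uminus_idem_comb: "- idem_comb \<epsilon> x y = idem_comb \<epsilon> (- x) (- y)"
  by (simp add: idem_comb_def cl2_eq_iff field_simps)

lemma idem_comb_mult:
  assumes "\<epsilon> \<in> E1"
  shows "idem_comb \<epsilon> x y * idem_comb \<epsilon> x' y' = idem_comb \<epsilon> (x * x') (y * y')"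
proof -
  have "idem_comb \<epsilon> x y * idem_comb \<epsilon> x' y' =
      ((x + y) / 2 * ((x' + y') / 2)) *\<^sub>R 1 + ((x + y) / 2 * ((x' - y') / 2)) *\<^sub>R \<epsilon>
      + ((x - y) / 2 * ((x' + y') / 2)) *\<^sub>R \<epsilon> + ((x - y) / 2 * ((x' - y') / 2)) *\<^sub>R (\<epsilon> * \<epsilon>)"
    by (simp add: idem_comb_def of_real_def algebra_simps)
  also have "\<dots> = idem_comb \<epsilon> (x * x') (y * y')"
    by (simp add: E1_square[OF assms] idem_comb_def cl2_eq_iff field_simps)
  finally show ?thesis .
qed

lemma idem_comb_power:
  assumes "\<epsilon> \<in> E1"
  shows "idem_comb \<epsilon> x y ^ n = idem_comb \<epsilon> (x ^ n) (y ^ n)"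
proof (induction n)
  case 0
  show ?case by (simp add: idem_comb_def)
next
  case (Suc n)
  then show ?case by (simp add: idem_comb_mult[OF assms])
qed

text \<open>\<open>1\<close> and \<open>\<epsilon>\<close> are linearly independent:
  \<open>\<epsilon>\<close> has no scalar part, and \<open>V_cl2 \<epsilon> = 1\<close> forces a
  nonzero vector coordinate.\<close>

lemma idem_comb_eq_iff:
  assumes "\<epsilon> \<in> E1"
  shows "idem_comb \<epsilon> x y = idem_comb \<epsilon> x' y' \<longleftrightarrow> x = x' \<and> y = y'"
proof
  assume eq: "idem_comb \<epsilon> x y = idem_comb \<epsilon> x' y'"
  have e: "c0 \<epsilon> = 0" "V_cl2 \<epsilon> = 1"
    using assms by (simp_all add: E1_iff)
  have "c1 \<epsilon> \<noteq> 0 \<or> c2 \<epsilon> \<noteq> 0 \<or> c3 \<epsilon> \<noteq> 0"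
    using e(2) by (auto simp: V_cl2_def)
  moreover have "x + y = x' + y'"
    using arg_cong[OF eq, of c0] e(1) by (simp add: idem_comb_def)
  moreover have "(x - y) * c1 \<epsilon> = (x' - y') * c1 \<epsilon>" "(x - y) * c2 \<epsilon> = (x' - y') * c2 \<epsilon>"
    "(x - y) * c3 \<epsilon> = (x' - y') * c3 \<epsilon>"
    using eq by (simp_all add: idem_comb_def cl2_eq_iff)
  ultimately show "x = x' \<and> y = y'"
    by auto
qed simp

lemma power_eq_idem_comb_iff:
  assumes "\<epsilon> \<in> E1" and "x \<noteq> y"
  shows "w ^ n = idem_comb \<epsilon> x y \<longleftrightarrow> (\<exists>u v. w = idem_comb \<epsilon> u v \<and> u ^ n = x \<and> v ^ n = y)"
proof
  assume w: "w ^ n = idem_comb \<epsilon> x y"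
  have "w * idem_comb \<epsilon> x y = idem_comb \<epsilon> x y * w"
    unfolding w[symmetric] by (simp add: power_commutes)
  \<comment> \<open>The scalar part of \<open>idem_comb \<epsilon> x y\<close> is central and
    cancels. What remains is the commutator of \<open>w\<close> and \<open>\<epsilon>\<close> scaled
    by \<open>(x - y) / 2\<close>, which is nonzero.\<close>
  then have "((x - y) / 2) *\<^sub>R (w * \<epsilon>) = ((x - y) / 2) *\<^sub>R (\<epsilon> * w)"
    by (simp add: idem_comb_def of_real_def ring_distribs)
  then have "w * \<epsilon> = \<epsilon> * w"
    using assms(2) by simp
  then obtain u v where "w = idem_comb \<epsilon> u v"
    using E1_centralizer[OF assms(1)] of_real_plus_scaleR_eq_idem_comb by metis
  with w show "\<exists>u v. w = idem_comb \<epsilon> u v \<and> u ^ n = x \<and> v ^ n = y"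
    by (auto simp: idem_comb_power[OF assms(1)] idem_comb_eq_iff[OF assms(1)])
qed (auto simp: idem_comb_power[OF assms(1)])

lemma odd_power_eq_power_iff:
  fixes x y :: real
  assumes "odd n"
  shows "x ^ n = y ^ n \<longleftrightarrow> x = y"
  using assms odd_real_root_power_cancel by metis

lemma even_power_eq_power_iff:
  fixes x y :: real
  assumes "even n" and "n > 0"
  shows "x ^ n = y ^ n \<longleftrightarrow> x = y \<or> x = - y"
proof -
  have "x ^ n = y ^ n \<longleftrightarrow> \<bar>x\<bar> ^ n = \<bar>y\<bar> ^ n"
    using assms(1) by (simp add: power_even_abs)
  also have "\<dots> \<longleftrightarrow> \<bar>x\<bar> = \<bar>y\<bar>"
    using assms(2) by (simp add: power_eq_iff_eq_base)
  finally show ?thesis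
    by (simp add: abs_eq_iff)
qed

theorem theorem3p1:
  fixes n :: nat and a \<epsilon> :: cl2 and \<theta> :: real
  assumes "n \<ge> 2"
    and "a \<in> S1"
    and "\<epsilon> \<in> E1"
    and "a = N_cl2 a *\<^sub>R (of_real (cosh \<theta>) + sinh \<theta> *\<^sub>R \<epsilon>)"
  shows "(odd n \<longrightarrow>
           (\<forall>w::cl2. w ^ n = a \<longleftrightarrow>
             w = root n (N_cl2 a) *\<^sub>R
                   (of_real (cosh (\<theta> / real n)) + sinh (\<theta> / real n) *\<^sub>R \<epsilon>))) \<and>
         (even n \<longrightarrow>
           (let w\<^sub>1 = root n (N_cl2 a) *\<^sub>R
                   (of_real (cosh (\<theta> / real n)) + sinh (\<theta> / real n) *\<^sub>R \<epsilon>);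
                w\<^sub>2 = root n (N_cl2 a) *\<^sub>R
                   (of_real (sinh (\<theta> / real n)) + cosh (\<theta> / real n) *\<^sub>R \<epsilon>)
            in w\<^sub>1 ^ n = a \<and> w\<^sub>2 ^ n = a \<and> w\<^sub>1 \<noteq> w\<^sub>2 \<and> w\<^sub>1 \<noteq> - w\<^sub>2 \<and>
               (\<forall>w::cl2. w ^ n = a \<longrightarrow> w \<in> {w\<^sub>1, - w\<^sub>1, w\<^sub>2, - w\<^sub>2})))"
proof -
  define N where "N = N_cl2 a"
  define r where "r = root n N"
  \<comment> \<open>\<open>X\<close> and \<open>Y\<close> will be the idempotent coordinates of the
    first root, because \<open>cosh t + sinh t = exp t\<close> and
    \<open>cosh t - sinh t = exp (- t)\<close>.\<close>
  define X where "X = r * exp (\<theta> / n)"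
  define Y where "Y = r * exp (- (\<theta> / n))"
  have n: "n > 0"
    using assms(1) by simp
  have N: "N > 0"
    using assms(2) by (simp add: N_def S1_def N_cl2_def)
  then have r: "r > 0" "r ^ n = N"
    using n by (simp_all add: r_def)
  then have XY: "X > 0" "Y > 0"
    by (simp_all add: X_def Y_def)
  have a_eq: "a = N *\<^sub>R (of_real (cosh \<theta>) + sinh \<theta> *\<^sub>R \<epsilon>)"
    using assms(4) by (simp add: N_def)
  have "V_cl2 a > 0"
    using assms(2) by (simp add: S1_def)
  \<comment> \<open>For \<open>\<theta> = 0\<close> the element \<open>a\<close> would be a real
    scalar, with \<open>V_cl2 a = 0\<close>.\<close>
  then have "\<theta> \<noteq> 0"
    by (auto simp: a_eq V_cl2_def)
  have pow: "X ^ n = N * exp \<theta>" "Y ^ n = N * exp (- \<theta>)"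
    using n r(2) by (simp_all add: X_def Y_def power_mult_distrib exp_of_nat_mult[symmetric])
  have w1: "r *\<^sub>R (of_real (cosh (\<theta> / n)) + sinh (\<theta> / n) *\<^sub>R \<epsilon>) = idem_comb \<epsilon> X Y"
    by (simp only: of_real_plus_scaleR_eq_idem_comb scaleR_idem_comb cosh_plus_sinh
        cosh_minus_sinh X_def Y_def)
  \<comment> \<open>Exchanging \<open>cosh\<close> and \<open>sinh\<close> keeps their sum and
    negates their difference, so only the second coordinate changes sign.\<close>
  have w2: "r *\<^sub>R (of_real (sinh (\<theta> / n)) + cosh (\<theta> / n) *\<^sub>R \<epsilon>) = idem_comb \<epsilon> X (- Y)"
    by (simp only: of_real_plus_scaleR_eq_idem_comb scaleR_idem_comb sinh_plus_cosh
        sinh_minus_cosh X_def Y_def mult_minus_right)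
  have a: "a = idem_comb \<epsilon> (X ^ n) (Y ^ n)"
    unfolding a_eq pow
    by (simp only: of_real_plus_scaleR_eq_idem_comb scaleR_idem_comb cosh_plus_sinh cosh_minus_sinh)
  have "X ^ n \<noteq> Y ^ n"
    using N \<open>\<theta> \<noteq> 0\<close> by (simp add: pow)
  then have roots: "w ^ n = a \<longleftrightarrow> (\<exists>u v. w = idem_comb \<epsilon> u v \<and> u ^ n = X ^ n \<and> v ^ n = Y ^ n)" for w
    unfolding a by (rule power_eq_idem_comb_iff[OF assms(3)])
  show ?thesis
    unfolding N_def[symmetric] r_def[symmetric] w1 w2 Let_def
  proof (intro conjI impI)
    assume "odd n"
    then show "\<forall>w. w ^ n = a \<longleftrightarrow> w = idem_comb \<epsilon> X Y"
      by (simp add: roots odd_power_eq_power_iff)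
  next
    assume "even n"
    note iff = even_power_eq_power_iff[OF this n]
    show "idem_comb \<epsilon> X Y ^ n = a" "idem_comb \<epsilon> X (- Y) ^ n = a"
      using \<open>even n\<close> by (simp_all add: idem_comb_power[OF assms(3)] a)
    \<comment> \<open>The first pair differs in the second coordinate, as \<open>Y > 0\<close>, and
      the other pair in the first, as \<open>X > 0\<close>.\<close>
    show "idem_comb \<epsilon> X Y \<noteq> idem_comb \<epsilon> X (- Y)" "idem_comb \<epsilon> X Y \<noteq> - idem_comb \<epsilon> X (- Y)"
      using XY by (simp_all add: uminus_idem_comb idem_comb_eq_iff[OF assms(3)])
    \<comment> \<open>For even \<open>n\<close> the coordinates of \<open>w\<close> are
      \<open>X\<close> or \<open>- X\<close> and \<open>Y\<close> or \<open>- Y\<close>. Equal signs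
      give the first root up to sign, opposite signs the second.\<close>
    show "\<forall>w. w ^ n = a \<longrightarrow>
        w \<in> {idem_comb \<epsilon> X Y, - idem_comb \<epsilon> X Y, idem_comb \<epsilon> X (- Y), - idem_comb \<epsilon> X (- Y)}"
      by (auto simp: roots iff uminus_idem_comb)
  qed
qed

end
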